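(* There is a constant $C$ such that for every sufficiently large $n$ there exists a $C_4$-free $1$-planar graph on $n$ vertices with at least $2.4n-C$ edges.
   Context: All graphs are finite and simple. A graph is $k$-planar if it admits a drawing in the plane in which every edge is crossed at most $k$ times. A graph is $C_\ell$-free if it contains no cycle of length $\ell$ as a subgraph. (The paper states the edge count as $2.4n-O(1)$.) *)

theory Defs
  imports "HOL-Analysis.Analysis"
begin

definition simple_graph :: "'a set \<Rightarrow> 'a set set \<Rightarrow> bool" where
  "simple_graph V E \<longleftrightarrow> finite V \<and>
     (\<forall>e\<in>E. \<exists>u v. u \<in> V \<and> v \<in> V \<and> u \<noteq> v \<and> e = {u, v})"

definition C4_free :: "'a set set \<Rightarrow> bool" where
  "C4_free E \<longleftrightarrow> \<not> (\<exists>a b c d. distinct [a, b, c, d] \<and>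
      {a, b} \<in> E \<and> {b, c} \<in> E \<and> {c, d} \<in> E \<and> {d, a} \<in> E)"

definition curve_interior :: "(real \<Rightarrow> real^2) \<Rightarrow> (real^2) set" where
  "curve_interior g = path_image g - {pathstart g, pathfinish g}"

definition is_drawing :: "'a set \<Rightarrow> 'a set set \<Rightarrow> ('a \<Rightarrow> real^2) \<Rightarrow> ('a set \<Rightarrow> real \<Rightarrow> real^2) \<Rightarrow> bool" where
  "is_drawing V E pos curve \<longleftrightarrow> inj_on pos V \<and>
     (\<forall>e\<in>E. arc (curve e) \<and> {pathstart (curve e), pathfinish (curve e)} = pos ` e \<and>
              path_image (curve e) \<inter> pos ` V = pos ` e)"

definition crossings :: "'a set set \<Rightarrow> ('a set \<Rightarrow> real \<Rightarrow> real^2) \<Rightarrow> 'a set \<Rightarrow> ('a set \<times> (real^2)) set" where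
  "crossings E curve e = {(f, p). f \<in> E \<and> f \<noteq> e \<and>
       p \<in> curve_interior (curve e) \<inter> curve_interior (curve f)}"

definition k_planar :: "nat \<Rightarrow> 'a set \<Rightarrow> 'a set set \<Rightarrow> bool" where
  "k_planar k V E \<longleftrightarrow> (\<exists>pos curve. is_drawing V E pos curve \<and>
     (\<forall>e\<in>E. finite (crossings E curve e) \<and> card (crossings E curve e) \<le> k))"

end

theory Submission
  imports Defs
begin

text \<open>
  The graph lives on \<open>{..<n}\<close>; vertex \<open>i\<close> is joined to \<open>i + d\<close> for certain steps
  \<open>d \<in> {1, 6, 7, 8, 9, 13}\<close> that depend on \<open>i mod 10\<close> only, \<open>24\<close> steps per period. Hence there are
  \<open>12/5\<close> edges per vertex up to a constant, and the absence of four-cycles is a finite check modulo \<open>10\<close>.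

  The vertices are rolled up on a helix with about seven vertices per turn: in the plane
  with polar coordinates, vertex \<open>i\<close> has radius \<open>i + 1\<close> and angle \<open>0\<close>, and the edge from \<open>i\<close> to \<open>i + d\<close> is a
  spiral that turns \<open>h = (d + 1) div 7\<close> times around the origin. In the universal cover of the
  punctured plane the vertices are the points of the lattice \<open>\<int>\<^sup>2\<close> and the edges are straight segments
  with direction \<open>(d, h)\<close>. Whether two segments cross depends on the residue of \<open>i\<close> and
  on their relative position, so that one-planarity is again a finite check on integers.
\<close>

section \<open>The periodic graph and its steps\<close>

text \<open>The table was found by a computer search over doubly periodic drawings.\<close>

definition step_table :: "int list list" where
  "step_table = [[8, 13], [1, 6], [7, 8, 9], [1, 7], [1, 7],
                 [6, 8, 13], [1, 6], [6, 7, 9], [1, 7, 8], [1, 7]]"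

definition steps :: "int \<Rightarrow> int list" where
  "steps i = step_table ! nat (i mod 10)"

text \<open>On the six steps this is the integer nearest to \<open>d / 7\<close>: 0 for 1, 2 for 13
  and 1 otherwise.\<close>

definition winding :: "int \<Rightarrow> int" where
  "winding d = (d + 1) div 7"

definition helix_edges :: "nat \<Rightarrow> nat set set" where
  "helix_edges n = {{i, j} | i j. i < j \<and> j < n \<and> int j - int i \<in> set (steps (int i))}"

lemma steps_mod: "steps (i mod 10) = steps i"
  by (simp add: steps_def)

lemma steps_mod_add: "steps (i mod 10 + d) = steps (i + d)"
  by (simp add: steps_def mod_simps)

lemma mod_10_mem: "(i::int) mod 10 \<in> set [0..9]"
  by simp

lemma steps_values:
  assumes "d \<in> set (steps i)"
  shows "d \<in> {1, 6, 7, 8, 9, 13}"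
proof -
  have "\<forall>r\<in>set [0..9]. \<forall>d\<in>set (steps r). d \<in> set [1, 6, 7, 8, 9, 13]"
    by code_simp
  from bspec[OF this mod_10_mem[of i]] assms show ?thesis
    by (auto simp: steps_mod)
qed

lemma steps_bounds:
  assumes "d \<in> set (steps i)"
  shows "1 \<le> d" "d \<le> 13" "0 \<le> winding d" "winding d \<le> 2"
  using steps_values[OF assms] by (auto simp: winding_def)

lemma helix_edgesE:
  assumes "e \<in> helix_edges n"
  obtains i d where "e = {i, i + d}" "0 < d" "i + d < n" "int d \<in> set (steps (int i))"
proof -
  from assms obtain i j where *: "e = {i, j}" "i < j" "j < n" "int j - int i \<in> set (steps (int i))"
    by (auto simp: helix_edges_def)
  show ?thesis
    by (rule that[of i "j - i"]) (use * in auto)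
qed

subsection \<open>Excluding four-cycles\<close>

text \<open>Displacements to the neighbours in the infinite periodic graph. Testing the six possible
  lengths for backward steps keeps the list executable.\<close>

definition signed_steps :: "int \<Rightarrow> int list" where
  "signed_steps i = steps i @
     map uminus (filter (\<lambda>d. d \<in> set (steps (i - d))) [1, 6, 7, 8, 9, 13])"

text \<open>Walks of length two that do not return, each recorded by its midpoint and its end
  relative to \<open>i\<close>.\<close>

definition two_steps :: "int \<Rightarrow> (int \<times> int) list" where
  "two_steps i = [(s, s + t). s \<leftarrow> signed_steps i, t \<leftarrow> signed_steps (i + s), s + t \<noteq> 0]"

lemma signed_steps_mod_add: "signed_steps (i mod 10 + d) = signed_steps (i + d)"
proof -
  have "steps (i mod 10 + d - e) = steps (i + d - e)" for e
    using steps_mod_add[of i "d - e"] by (simp add: algebra_simps)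
  then show ?thesis
    by (simp add: signed_steps_def steps_mod_add)
qed

lemma two_steps_mod: "two_steps (i mod 10) = two_steps i"
  using signed_steps_mod_add[of i 0] by (simp add: two_steps_def signed_steps_mod_add)

text \<open>A four-cycle would give two such walks with equal ends and different midpoints.
  Evaluation on the ten residues rules this out.\<close>

lemma two_steps_inj: "inj_on snd (set (two_steps i))"
proof -
  have "\<forall>r\<in>set [0..9]. \<forall>x\<in>set (two_steps r). \<forall>y\<in>set (two_steps r). snd x = snd y \<longrightarrow> x = y"
    by code_simp
  from bspec[OF this mod_10_mem[of i]] show ?thesis
    by (simp add: two_steps_mod inj_on_def)
qed

lemma edge_signed_step:
  assumes "{a, b} \<in> helix_edges n"
  shows "int b - int a \<in> set (signed_steps (int a))"
proof -
  obtain i d where e: "{a, b} = {i, i + d}" "0 < d" and d: "int d \<in> set (steps (int i))"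
    using assms by (rule helix_edgesE)
  from e consider "a = i" "b = i + d" | "a = i + d" "b = i"
    by (auto simp: doubleton_eq_iff)
  then show ?thesis
  proof cases
    case 2
    then show ?thesis
      using d steps_values[OF d] by (auto simp: signed_steps_def)
  qed (use d in \<open>simp add: signed_steps_def\<close>)
qed

lemma C4_free_helix: "C4_free (helix_edges n)"
  unfolding C4_free_def
proof (intro notI, elim exE conjE)
  fix a b c d :: nat
  assume dist: "distinct [a, b, c, d]"
    and edges: "{a, b} \<in> helix_edges n" "{b, c} \<in> helix_edges n"
      "{c, d} \<in> helix_edges n" "{d, a} \<in> helix_edges n"
  \<comment> \<open>Both \<open>b\<close> and \<open>d\<close> will serve as \<open>x\<close>, the
    midpoint of a walk from \<open>a\<close> to \<open>c\<close>; the walk does not return because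
    \<open>a\<close> and \<open>c\<close> differ.\<close>
  have two: "(int x - int a, int c - int a) \<in> set (two_steps (int a))"
    if "{a, x} \<in> helix_edges n" "{x, c} \<in> helix_edges n" for x
    using edge_signed_step[OF that(1)] edge_signed_step[OF that(2)] dist
    by (force simp: two_steps_def image_iff)
  have "(int b - int a, int c - int a) = (int d - int a, int c - int a)"
    by (rule inj_onD[OF two_steps_inj[of "int a"]])
      (use edges in \<open>auto intro!: two simp: insert_commute\<close>)
  with dist show False
    by simp
qed

subsection \<open>Counting edges\<close>

lemma card_helix_edges: "24 * ((n - 13) div 10) \<le> card (helix_edges n)"
proof -
  \<comment> \<open>Starting points stay below \<open>n - 13\<close>, so the longest step still ends
    below \<open>n\<close>; truncated subtraction gives \<open>m = 0\<close> for small
    \<open>n\<close>.\<close>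
  define m where "m = (n - 13) div 10"
  define P where "P = (SIGMA i:{..<10 * m}. set (steps (int i)))"
  define f where "f = (\<lambda>(i, d). {i, i + nat d})"
  have lt: "i + nat d < n" if "i < 10 * m" "d \<in> set (steps (int i))" for i d
    using that(1) steps_bounds[OF that(2)] unfolding m_def by linarith
  have inj: "inj_on f P"
  proof (rule inj_onI, clarify)
    fix i d j e
    assume "(i, d) \<in> P" "(j, e) \<in> P" and eq: "f (i, d) = f (j, e)"
    \<comment> \<open>Both steps are positive, so the starting point is the smaller element of the
      pair.\<close>
    then have "1 \<le> d" "1 \<le> e"
      by (auto simp: P_def dest: steps_bounds)
    with eq show "i = j \<and> d = e"
      by (auto simp: f_def doubleton_eq_iff)
  qed
  have sub: "f ` P \<subseteq> helix_edges n"
  proof clarify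
    fix i d assume "(i, d) \<in> P"
    then have d: "i < 10 * m" "d \<in> set (steps (int i))"
      by (auto simp: P_def)
    then have "i < i + nat d" "int (i + nat d) - int i = d"
      using steps_bounds[OF d(2)] by auto
    with d lt[OF d] show "f (i, d) \<in> helix_edges n"
      unfolding helix_edges_def f_def prod.case mem_Collect_eq
      by (intro exI[of _ i] exI[of _ "i + nat d"]) simp
  qed
  have fin: "finite (helix_edges n)"
    by (rule finite_subset[of _ "Pow {..<n}"]) (auto simp: helix_edges_def)
  have "card P = (\<Sum>i<10 * m. card (set (steps (int i))))"
    by (simp add: P_def)
  also have "\<dots> = 24 * m"
  proof (induction m)
    case (Suc m)
    have period: "steps (int (10 * m + r)) = steps (int r)" for r
      using steps_mod[of "int (10 * m + r)"] steps_mod[of "int r"] by (simp add: mod_simps)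
    have "(\<Sum>i<10 * Suc m. card (set (steps (int i)))) =
        (\<Sum>i<10 * m. card (set (steps (int i)))) + (\<Sum>r<10. card (set (steps (int (10 * m + r)))))"
      using sum.atLeastLessThan_concat[of 0 "10 * m" "10 * m + 10" "\<lambda>i. card (set (steps (int i)))"]
        sum.shift_bounds_nat_ivl[of "\<lambda>i. card (set (steps (int i)))" 0 "10 * m" 10]
      by (simp add: lessThan_atLeast0 add.commute)
    also have "(\<Sum>r<10. card (set (steps (int (10 * m + r))))) = (\<Sum>r<10. card (set (steps (int r))))"
      by (simp only: period)
    also have "\<dots> = 24"
      by code_simp
    finally show ?case
      using Suc by simp
  qed simp
  finally have "24 * m = card (f ` P)"
    using inj by (simp add: card_image)
  also have "\<dots> \<le> card (helix_edges n)"
    by (rule card_mono[OF fin sub])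
  finally show ?thesis
    by (simp add: m_def)
qed

subsection \<open>The spiral drawing\<close>

text \<open>The covering map of the punctured plane: \<open>v\<close> counts turns, and the shift by
  1 keeps the radius positive for \<open>u \<ge> 0\<close>.\<close>

definition polar :: "real \<Rightarrow> real \<Rightarrow> real^2" where
  "polar u v = vector [(u + 1) * cos (2 * pi * v), (u + 1) * sin (2 * pi * v)]"

text \<open>The squared norm recovers the radius, which is positive; sine and cosine then fix the
  angle up to full turns.\<close>

lemma polar_eq_iff:
  assumes "0 \<le> u" "0 \<le> u'"
  shows "polar u v = polar u' v' \<longleftrightarrow> u = u' \<and> (\<exists>k::int. v = v' + k)"
proof
  assume "polar u v = polar u' v'"
  then have eq: "(u + 1) * cos (2 * pi * v) = (u' + 1) * cos (2 * pi * v')"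
      "(u + 1) * sin (2 * pi * v) = (u' + 1) * sin (2 * pi * v')"
    by (auto simp: polar_def vec_eq_iff forall_2)
  have norm: "(w + 1)\<^sup>2 = ((w + 1) * cos x)\<^sup>2 + ((w + 1) * sin x)\<^sup>2" for w x :: real
    by (simp add: power_mult_distrib flip: distrib_left)
  have "(u + 1)\<^sup>2 = (u' + 1)\<^sup>2"
    using norm[of u "2 * pi * v"] norm[of u' "2 * pi * v'"] by (simp add: eq)
  then have u: "u = u'"
    using assms by (simp add: power2_eq_iff)
  with eq assms have "sin (2 * pi * v) = sin (2 * pi * v') \<and> cos (2 * pi * v) = cos (2 * pi * v')"
    by auto
  then obtain k :: int where "2 * pi * v = 2 * pi * v' + 2 * pi * k"
    by (auto simp: sin_cos_eq_iff)
  then have "2 * pi * v = 2 * pi * (v' + k)"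
    by (simp add: distrib_left)
  with u show "u = u' \<and> (\<exists>k::int. v = v' + k)"
    by auto
next
  assume "u = u' \<and> (\<exists>k::int. v = v' + k)"
  then obtain k :: int where k: "u = u'" "v = v' + k"
    by auto
  have "sin (2 * pi * v) = sin (2 * pi * v') \<and> cos (2 * pi * v) = cos (2 * pi * v')"
    unfolding sin_cos_eq_iff by (rule exI[of _ k]) (simp add: k distrib_left)
  with k show "polar u v = polar u' v'"
    by (simp add: polar_def)
qed

definition spiral :: "nat \<Rightarrow> nat \<Rightarrow> real \<Rightarrow> real^2" where
  "spiral i d s = polar (real i + s * real d) (s * real_of_int (winding (int d)))"

text \<open>An edge is an unordered pair; \<open>Min\<close> and \<open>Max\<close> recover its
  start and its step.\<close>

definition edge_curve :: "nat set \<Rightarrow> real \<Rightarrow> real^2" where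
  "edge_curve e = spiral (Min e) (Max e - Min e)"

definition vertex_point :: "nat \<Rightarrow> real^2" where
  "vertex_point i = polar (real i) 0"

lemma edge_curve_eq: "edge_curve {i, i + d} = spiral i d"
  by (simp add: edge_curve_def)

lemma spiral_0: "spiral i d 0 = vertex_point i"
  by (simp add: spiral_def vertex_point_def)

text \<open>The number of turns is an integer, so the spiral ends on the ray of angle 0.\<close>

lemma spiral_1: "spiral i d 1 = vertex_point (i + d)"
  by (auto simp: spiral_def vertex_point_def polar_eq_iff)

text \<open>Meeting spirals lift to meeting straight segments, the second lift being shifted by
  \<open>k\<close> turns.\<close>

lemma spiral_eqE:
  assumes "spiral i d s = spiral j e t" "0 \<le> s" "0 \<le> t"
  obtains k where "s * real d = real_of_int (int j - int i) + t * real e"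
    "s * real_of_int (winding (int d)) = real_of_int k + t * real_of_int (winding (int e))"
proof -
  from assms obtain k where "real i + s * real d = real j + t * real e"
      "s * real_of_int (winding (int d)) = t * real_of_int (winding (int e)) + real_of_int k"
    by (auto simp: spiral_def polar_eq_iff)
  then show ?thesis
    by (intro that[of k]) auto
qed

lemma continuous_on_spiral: "continuous_on S (spiral i d)"
proof -
  have "spiral i d = (\<lambda>s. \<chi> c. if c = 1
      then (real i + s * real d + 1) * cos (2 * pi * (s * real_of_int (winding (int d))))
      else (real i + s * real d + 1) * sin (2 * pi * (s * real_of_int (winding (int d)))))"
    by (auto simp: spiral_def polar_def vec_eq_iff forall_2)
  moreover have "continuous_on S \<dots>"
  proof (rule continuous_on_vec_lambda)
    fix c :: 2
    show "continuous_on S (\<lambda>s. if c = 1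
        then (real i + s * real d + 1) * cos (2 * pi * (s * real_of_int (winding (int d))))
        else (real i + s * real d + 1) * sin (2 * pi * (s * real_of_int (winding (int d)))))"
      by (cases "c = 1") (auto intro!: continuous_intros)
  qed
  ultimately show ?thesis
    by simp
qed

lemma path_image_spiral: "path_image (spiral i d) = spiral i d ` {0..1}"
  by (simp add: path_image_def)

text \<open>Injective because the radius grows strictly when \<open>0 < d\<close>.\<close>

lemma arc_spiral:
  assumes "0 < d"
  shows "arc (spiral i d)"
  unfolding arc_def path_def
proof (intro conjI continuous_on_spiral inj_onI)
  fix s t :: real
  assume "s \<in> {0..1}" "t \<in> {0..1}" "spiral i d s = spiral i d t"
  then have "s * real d = t * real d"
    by (auto elim!: spiral_eqE[of i d s i d t])
  with assms show "s = t"
    by simp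
qed

lemma curve_interior_spiralE:
  assumes "p \<in> curve_interior (spiral i d)"
  obtains s where "0 < s" "s < 1" "p = spiral i d s"
proof -
  obtain s where s: "0 \<le> s" "s \<le> 1" "p = spiral i d s"
    using assms by (auto simp: curve_interior_def path_image_def)
  moreover have "s \<noteq> 0" "s \<noteq> 1"
    using assms s by (auto simp: curve_interior_def pathstart_def pathfinish_def)
  ultimately show ?thesis
    using that[of s] by linarith
qed

text \<open>The direction \<open>(d, winding d)\<close> is a primitive lattice vector for each of
  the six steps, so the lifted segment has no lattice point in its interior.\<close>

lemma spiral_through_vertex:
  assumes "int d \<in> set (steps i')" and s: "0 \<le> s" "s \<le> 1" and eq: "spiral i d s = vertex_point j"
  shows "s = 0 \<or> s = 1"
proof -
  \<comment> \<open>The vertex is viewed as the start of a spiral of step 0, so that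
    \<open>spiral_eqE\<close> applies.\<close>
  obtain k where eq: "s * real d = real_of_int (int j - int i)"
    "s * real_of_int (winding (int d)) = real_of_int k"
    using eq s unfolding spiral_0[of j 0, symmetric]
    by (elim spiral_eqE) auto
  define l where "l = int j - int i"
  have "d \<in> {1, 6, 7, 8, 9, 13}"
    using steps_values[OF assms(1)] by auto
  then consider "d = 1" | "winding (int d) = 1" | "d = 13" "winding (int d) = 2"
    by (auto simp: winding_def)
  then show ?thesis
  proof cases
    case 1
    then have "0 \<le> l" "l \<le> 1" "s = l"
      using eq s by (auto simp: l_def)
    moreover from this have "l = 0 \<or> l = 1"
      by linarith
    ultimately show ?thesis
      by auto
  next
    case 2
    then have "0 \<le> k" "k \<le> 1" "s = k"
      using eq s by auto
    moreover from this have "k = 0 \<or> k = 1"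
      by linarith
    ultimately show ?thesis
      by auto
  next
    case 3
    then have k: "0 \<le> k" "k \<le> 2" "s * 2 = k" and l: "s * 13 = l"
      using eq s by (auto simp: l_def)
    then have "real_of_int (13 * k) = real_of_int (2 * l)"
      by auto
    then have "13 * k = 2 * l"
      by linarith
    then have "k \<noteq> 1"
      by presburger
    with k have "k = 0 \<or> k = 2"
      by linarith
    with k show ?thesis
      by auto
  qed
qed

subsection \<open>Crossings\<close>

text \<open>
  The segments are \<open>(0, 0) \<rightarrow> (d, g)\<close> and \<open>(l, k) \<rightarrow> (l + e, k + h)\<close>. The arguments of \<open>one_sided\<close> are the
  orientations of the end points of one segment relative to the line through the other. One of
  them may vanish, so that segments with a common end point count as separated.
\<close>

definition one_sided :: "int \<Rightarrow> int \<Rightarrow> bool" where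
  "one_sided a b \<longleftrightarrow> (0 \<le> a \<and> 0 \<le> b \<and> 0 < a + b) \<or> (a \<le> 0 \<and> b \<le> 0 \<and> a + b < 0)"

definition separated :: "int \<Rightarrow> int \<Rightarrow> int \<Rightarrow> int \<Rightarrow> int \<Rightarrow> int \<Rightarrow> bool" where
  "separated d g e h l k \<longleftrightarrow> d \<le> l \<or> l + e \<le> 0 \<or>
     one_sided (d * k - g * l) (d * (k + h) - g * (l + e)) \<or>
     one_sided (h * l - e * k) (h * (l - d) - e * (k - g))"

text \<open>With positive weights, two numbers of the same weak sign, not both zero, average to a
  number of that strict sign.\<close>

lemma one_sided_interior:
  assumes "one_sided a b" "0 < t" "t < 1"
  shows "(1 - t) * real_of_int a + t * real_of_int b \<noteq> 0"
proof -
  have pos: "0 < (1 - t) * real_of_int x + t * real_of_int y"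
    if "0 \<le> x" "0 \<le> y" "0 < x + y" for x y
  proof (cases "x = 0")
    case True
    with that assms show ?thesis
      by simp
  next
    case False
    with that assms show ?thesis
      by (intro add_pos_nonneg) auto
  qed
  from assms(1) show ?thesis
    using pos[of a b] pos[of "- a" "- b"] by (auto simp: one_sided_def)
qed

lemma separated_segments:
  assumes sep: "separated d g e h l k" and "0 < d" "0 < e"
    and s: "0 < s" "s < 1" and t: "0 < t" "t < 1"
    and u: "s * real_of_int d = real_of_int l + t * real_of_int e"
    and v: "s * real_of_int g = real_of_int k + t * real_of_int h"
  shows False
proof -
  have "s * real_of_int d < real_of_int d" "0 < s * real_of_int d"
    "t * real_of_int e < real_of_int e" "0 < t * real_of_int e"
    using assms(2,3) s t by simp_all
  then have "\<not> d \<le> l" "\<not> l + e \<le> 0"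
    using u by linarith+
  \<comment> \<open>Orientation is affine along a segment, hence a convex combination of its end
    values, and it vanishes at a common point.\<close>
  moreover have "(1 - t) * real_of_int (d * k - g * l) + t * real_of_int (d * (k + h) - g * (l + e)) =
      real_of_int d * (real_of_int k + t * real_of_int h) - real_of_int g * (real_of_int l + t * real_of_int e)"
    by (simp add: algebra_simps)
  then have "(1 - t) * real_of_int (d * k - g * l) + t * real_of_int (d * (k + h) - g * (l + e)) = 0"
    by (simp flip: u v)
  moreover have "(1 - s) * real_of_int (h * l - e * k) + s * real_of_int (h * (l - d) - e * (k - g)) =
      real_of_int h * (real_of_int l - s * real_of_int d) - real_of_int e * (real_of_int k - s * real_of_int g)"
    by (simp add: algebra_simps)
  then have "(1 - s) * real_of_int (h * l - e * k) + s * real_of_int (h * (l - d) - e * (k - g)) = 0"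
    by (simp add: u v)
  ultimately show False
    using sep one_sided_interior[OF _ t] one_sided_interior[OF _ s] unfolding separated_def by blast
qed

text \<open>Lifted edges, given by offset \<open>l\<close>, step \<open>e\<close> and turn shift
  \<open>k\<close>, that may cross the one of step \<open>d\<close> from \<open>i\<close>. The
  triple \<open>(0, d, 0)\<close> is that edge itself.\<close>

definition crossers :: "int \<Rightarrow> int \<Rightarrow> (int \<times> int \<times> int) list" where
  "crossers i d = [(l, e, k). l \<leftarrow> [-12..12], e \<leftarrow> steps (i + l), k \<leftarrow> [-1, 0, 1],
     (l, e, k) \<noteq> (0, d, 0) \<and> \<not> separated d (winding d) e (winding e) l k]"

lemma crossers_mod: "crossers (i mod 10) d = crossers i d"
  by (simp add: crossers_def steps_mod_add)

text \<open>Evaluation on the ten residues. The length bound leaves at most one crossing edge;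
  non-parallel directions leave at most one crossing point.\<close>

lemma crossers_unique_transversal:
  assumes "d \<in> set (steps i)"
  shows "length (crossers i d) \<le> 1"
    and "(l, e, k) \<in> set (crossers i d) \<Longrightarrow> d * winding e \<noteq> winding d * e"
proof -
  have "\<forall>r\<in>set [0..9]. \<forall>d\<in>set (steps r). length (crossers r d) \<le> 1 \<and>
      (\<forall>(l, e, k)\<in>set (crossers r d). d * winding e \<noteq> winding d * e)"
    by code_simp
  from bspec[OF bspec[OF this mod_10_mem[of i]], of d] assms
  show "length (crossers i d) \<le> 1"
    "(l, e, k) \<in> set (crossers i d) \<Longrightarrow> d * winding e \<noteq> winding d * e"
    by (auto simp: steps_mod crossers_mod)
qed

lemma spiral_crossing:
  assumes d: "int d \<in> set (steps (int i))" and e: "int e \<in> set (steps (int j))"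
    and ne: "(i, d) \<noteq> (j, e)"
    and s: "0 < s" "s < 1" and t: "0 < t" "t < 1" and eq: "spiral i d s = spiral j e t"
  obtains k where "(int j - int i, int e, k) \<in> set (crossers (int i) (int d))"
    "s * real d = real_of_int (int j - int i) + t * real e"
    "s * real_of_int (winding (int d)) = real_of_int k + t * real_of_int (winding (int e))"
proof -
  define l where "l = int j - int i"
  obtain k where u: "s * real d = real_of_int l + t * real e"
    and v: "s * real_of_int (winding (int d)) = real_of_int k + t * real_of_int (winding (int e))"
    using spiral_eqE[OF eq] s t unfolding l_def by auto
  note bd = steps_bounds[OF d] and be = steps_bounds[OF e]
  have scale: "0 \<le> x * y \<and> x * y < z" if "0 < x" "x < 1" "0 \<le> y" "y \<le> z" "0 < z" for x y z :: real
  proof -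
    have "x * y \<le> x * z" "x * z < z"
      using that by (simp_all add: mult_left_mono)
    moreover have "0 \<le> x * y"
      using that by simp
    ultimately show ?thesis
      by linarith
  qed
  have "0 \<le> s * real d \<and> s * real d < 13" "0 \<le> t * real e \<and> t * real e < 13"
    "0 \<le> s * real_of_int (winding (int d)) \<and> s * real_of_int (winding (int d)) < 2"
    "0 \<le> t * real_of_int (winding (int e)) \<and> t * real_of_int (winding (int e)) < 2"
    by (rule scale; use s t bd be in linarith)+
  \<comment> \<open>\<open>l\<close> is a difference of two numbers in \<open>[0, 13)\<close> and
    \<open>k\<close> of two numbers in \<open>[0, 2)\<close>, so the finite window of
    \<open>crossers\<close> contains them.\<close>
  then have "-13 < l" "l < 13" "-2 < k" "k < 2"
    using u v by linarith+
  then have "l \<in> {-12..12}" "k \<in> set [-1, 0, 1]"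
    by auto
  moreover have "\<not> separated (int d) (winding (int d)) (int e) (winding (int e)) l k"
    using separated_segments[of "int d" "winding (int d)" "int e" "winding (int e)" l k s t]
      u v s t bd be by auto
  moreover have "(l, int e, k) \<noteq> (0, int d, 0)"
    using ne by (auto simp: l_def)
  moreover have "int e \<in> set (steps (int i + l))"
    using e by (simp add: l_def)
  ultimately have "(l, int e, k) \<in> set (crossers (int i) (int d))"
    unfolding crossers_def by (auto simp del: upto_rec_numeral)
  then show ?thesis
    using that u v unfolding l_def by blast
qed

lemma spiral_crossing_unique:
  assumes d: "int d \<in> set (steps (int i))"
    and e: "int e \<in> set (steps (int j))" "(i, d) \<noteq> (j, e)"
    and f: "int f \<in> set (steps (int m))" "(i, d) \<noteq> (m, f)"
    and s: "0 < s" "s < 1" and t: "0 < t" "t < 1" and eq: "spiral i d s = spiral j e t"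
    and s': "0 < s'" "s' < 1" and t': "0 < t'" "t' < 1" and eq': "spiral i d s' = spiral m f t'"
  shows "m = j \<and> f = e \<and> s' = s"
proof -
  obtain k where k: "(int j - int i, int e, k) \<in> set (crossers (int i) (int d))"
    "s * real d = real_of_int (int j - int i) + t * real e"
    "s * real_of_int (winding (int d)) = real_of_int k + t * real_of_int (winding (int e))"
    using d e s t eq by (rule spiral_crossing)
  obtain k' where k': "(int m - int i, int f, k') \<in> set (crossers (int i) (int d))"
    "s' * real d = real_of_int (int m - int i) + t' * real f"
    "s' * real_of_int (winding (int d)) = real_of_int k' + t' * real_of_int (winding (int f))"
    using d f s' t' eq' by (rule spiral_crossing)
  have "x = y" if "x \<in> set xs" "y \<in> set xs" "length xs \<le> 1" for x y and xs :: "(int \<times> int \<times> int) list"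
    using that by (cases xs) auto
  from this[OF k(1) k'(1) crossers_unique_transversal(1)[OF d]]
  have same: "m = j" "f = e" "k' = k"
    by auto
  \<comment> \<open>Both crossings belong to the same pair of lifted segments; eliminating
    \<open>t' - t\<close> leaves \<open>s' - s\<close> times a nonzero determinant.\<close>
  have "(s' - s) * real d = (t' - t) * real e"
    "(s' - s) * real_of_int (winding (int d)) = (t' - t) * real_of_int (winding (int e))"
    using k(2,3) k'(2,3) by (simp_all add: same algebra_simps)
  then have "(s' - s) * (real d * real_of_int (winding (int e)) - real_of_int (winding (int d)) * real e) = 0"
    by algebra
  moreover have "int d * winding (int e) \<noteq> winding (int d) * int e"
    using crossers_unique_transversal(2)[OF d k(1)] .
  then have "real_of_int (int d * winding (int e)) \<noteq> real_of_int (winding (int d) * int e)"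
    by (simp only: of_int_eq_iff not_False_eq_True)
  then have "real d * real_of_int (winding (int e)) - real_of_int (winding (int d)) * real e \<noteq> 0"
    by simp
  ultimately show ?thesis
    using same by simp
qed

section \<open>Validity and 1-planarity of the drawing\<close>

lemma is_drawing_helix: "is_drawing {..<n} (helix_edges n) vertex_point edge_curve"
  unfolding is_drawing_def
proof (intro conjI ballI)
  show "inj_on vertex_point {..<n}"
    by (auto simp: inj_on_def vertex_point_def polar_eq_iff)
next
  fix e assume "e \<in> helix_edges n"
  then obtain i d where e: "e = {i, i + d}" "0 < d" "i + d < n" and d: "int d \<in> set (steps (int i))"
    by (rule helix_edgesE)
  show "arc (edge_curve e)"
    using e by (simp add: edge_curve_eq arc_spiral)
  show "{pathstart (edge_curve e), pathfinish (edge_curve e)} = vertex_point ` e"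
    by (simp add: e edge_curve_eq pathstart_def pathfinish_def spiral_0 spiral_1)
  have "vertex_point i \<in> path_image (spiral i d)" "vertex_point (i + d) \<in> path_image (spiral i d)"
    using spiral_0[of i d] spiral_1[of i d]
      pathstart_in_path_image[of "spiral i d"] pathfinish_in_path_image[of "spiral i d"]
    by (simp_all add: pathstart_def pathfinish_def)
  moreover have "p \<in> vertex_point ` {i, i + d}"
    if p: "p \<in> spiral i d ` {0..1} \<inter> vertex_point ` {..<n}" for p
  proof -
    from p obtain s j where "0 \<le> s" "s \<le> 1" "p = spiral i d s" "spiral i d s = vertex_point j"
      by auto
    with spiral_through_vertex[OF d this(1,2,4)] show ?thesis
      using spiral_0[of i d] spiral_1[of i d] by (metis imageI insertCI)
  qed
  ultimately show "path_image (edge_curve e) \<inter> vertex_point ` {..<n} = vertex_point ` e"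
    unfolding e(1) edge_curve_eq
    by (intro equalityI subsetI) (use e in \<open>auto simp: path_image_spiral simp del: image_insert\<close>)
qed

lemma crossings_helix_unique:
  assumes "e \<in> helix_edges n"
    and c: "c \<in> crossings (helix_edges n) edge_curve e"
    and c': "c' \<in> crossings (helix_edges n) edge_curve e"
  shows "c' = c"
proof -
  obtain i d where e: "e = {i, i + d}" and d: "int d \<in> set (steps (int i))"
    using assms(1) by (rule helix_edgesE)
  have crossingE: "\<exists>j f s t. x = ({j, j + f}, spiral i d s) \<and> int f \<in> set (steps (int j)) \<and>
      (i, d) \<noteq> (j, f) \<and> 0 < s \<and> s < 1 \<and> 0 < t \<and> t < 1 \<and> spiral i d s = spiral j f t"
    if "x \<in> crossings (helix_edges n) edge_curve e" for x
  proof -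
    obtain g p where x: "x = (g, p)" "g \<in> helix_edges n" "g \<noteq> e"
      "p \<in> curve_interior (edge_curve e)" "p \<in> curve_interior (edge_curve g)"
      using \<open>x \<in> _\<close> by (auto simp: crossings_def)
    obtain j f where g: "g = {j, j + f}" "int f \<in> set (steps (int j))"
      using x(2) by (rule helix_edgesE)
    obtain s where "0 < s" "s < 1" "p = spiral i d s"
      using x(4) by (auto simp: e edge_curve_eq elim: curve_interior_spiralE)
    moreover obtain t where "0 < t" "t < 1" "p = spiral j f t"
      using x(5) by (auto simp: g edge_curve_eq elim: curve_interior_spiralE)
    moreover have "(i, d) \<noteq> (j, f)"
      using x(3) e g by auto
    ultimately show ?thesis
      using x(1) g by (intro exI[of _ j] exI[of _ f] exI[of _ s] exI[of _ t]) simp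
  qed
  from crossingE[OF c] obtain j f s t
    where 1: "int f \<in> set (steps (int j))" "(i, d) \<noteq> (j, f)" "0 < s" "s < 1" "0 < t" "t < 1"
      "spiral i d s = spiral j f t" and c_eq: "c = ({j, j + f}, spiral i d s)"
    by blast
  from crossingE[OF c'] obtain j' f' s' t'
    where 2: "int f' \<in> set (steps (int j'))" "(i, d) \<noteq> (j', f')" "0 < s'" "s' < 1" "0 < t'" "t' < 1"
      "spiral i d s' = spiral j' f' t'" and c'_eq: "c' = ({j', j' + f'}, spiral i d s')"
    by blast
  have "j' = j \<and> f' = f \<and> s' = s"
    by (rule spiral_crossing_unique[OF d 1(1,2) 2(1,2) 1(3-7) 2(3-7)])
  then show ?thesis
    by (simp add: c_eq c'_eq)
qed

lemma k_planar_helix: "k_planar 1 {..<n} (helix_edges n)"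
  unfolding k_planar_def
proof (intro exI conjI ballI)
  show "is_drawing {..<n} (helix_edges n) vertex_point edge_curve"
    by (rule is_drawing_helix)
next
  fix e assume e: "e \<in> helix_edges n"
  let ?X = "crossings (helix_edges n) edge_curve e"
  \<comment> \<open>\<open>SOME\<close> yields an arbitrary default if the set is empty, so one
    singleton covers both cases.\<close>
  have sub: "?X \<subseteq> {SOME c. c \<in> ?X}"
    using crossings_helix_unique[OF e] by (metis (mono_tags) singletonI someI subsetI)
  show "finite ?X"
    using sub by (rule finite_subset) simp
  show "card ?X \<le> 1"
    using card_mono[OF _ sub] by simp
qed

theorem theorem7:
  shows "\<exists>C::real. \<exists>N::nat. \<forall>n\<ge>N. \<exists>(V::nat set) E.
           simple_graph V E \<and> card V = n \<and> C4_free E \<and> k_planar 1 V E \<and>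
           real (card E) \<ge> 12/5 * real n - C"
proof (intro exI[of _ "56 :: real"] exI[of _ "0 :: nat"] allI impI)
  fix n :: nat
  have "simple_graph {..<n} (helix_edges n)"
    unfolding simple_graph_def
  proof (intro conjI ballI)
    fix e assume "e \<in> helix_edges n"
    then obtain i d where "e = {i, i + d}" "0 < d" "i + d < n"
      by (rule helix_edgesE)
    then show "\<exists>u v. u \<in> {..<n} \<and> v \<in> {..<n} \<and> u \<noteq> v \<and> e = {u, v}"
      by (intro exI[of _ i] exI[of _ "i + d"]) auto
  qed simp
  \<comment> \<open>At most \<open>13 + 9 = 22\<close> vertices fall outside the counted periods,
    and 22 times 12/5 is 52.8, below 56.\<close>
  moreover have "n \<le> 10 * ((n - 13) div 10) + 22"
    by linarith
  then have "12 / 5 * real n - 56 \<le> real (24 * ((n - 13) div 10))"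
    by simp
  then have "12 / 5 * real n - 56 \<le> real (card (helix_edges n))"
    using card_helix_edges[of n] by linarith
  ultimately show "\<exists>V E. simple_graph (V :: nat set) E \<and> card V = n \<and> C4_free E \<and> k_planar 1 V E \<and>
      12 / 5 * real n - 56 \<le> real (card E)"
    using C4_free_helix k_planar_helix by (intro exI[of _ "{..<n}"] exI[of _ "helix_edges n"]) auto
qed

end
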